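(* Fix a vehicle $k$ and let $L_1,L_2$ range over labels (of partial paths starting at the depot $\sigma$ and served by vehicle $k$). The following conditions form a valid dominance rule, i.e. $L_1$ dominates $L_2$ whenever $$i(L_1)=i(L_2),\quad t(L_1)\le t(L_2),\quad \bar c(L_1)\le \bar c(L_2),\quad d(L_1)=d(L_2),\quad \mathcal S(L_1)\subseteq \mathcal S(L_2),$$ $$l_m^k(L_1)\le l_m^k(L_2)\ \text{ and }\ O_m^k(L_1)\subseteq O_m^k(L_2)\ \text{ for all } m\in\mathcal M_k,\quad g(L_1)\le g(L_2),\quad o(L_1)\le o(L_2).$$ That is, if $L_1$ and $L_2$ satisfy all these conditions, then for every feasible completion of $L_2$ to the destination $\delta$ there is a feasible completion of $L_1$ to $\delta$ whose final reduced cost is at most the final reduced cost of the completion of $L_2$ (so that discarding $L_2$ loses no optimal value of the pricing problem).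
   Context: **Instance.** Let $\mathcal G=(\mathcal V,\mathcal A)$ be a finite directed graph with $\mathcal V=\mathcal N\cup\{\sigma,\delta\}$, where $\mathcal N$ is the set of clients, and $\sigma$ and $\delta$ are the origin and destination copies of the depot. Each client $n\in\mathcal N$ has a demand $Q_n\ge 0$, a service duration $u_n\ge 0$, and a finite nonempty list of time windows $[s_n^1,e_n^1],\dots,[s_n^{\theta_n},e_n^{\theta_n}]$ for the start of service, which are pairwise disjoint, ordered chronologically, and nonnegative. Each arc $(i,j)\in\mathcal A$ has a travel cost $c_{ij}$, a travel duration $t_{ij}\ge 0$ and a travel distance $dist_{ij}\ge 0$; costs and durations satisfy the triangle inequality. The planning days are $\mathcal D$, a set of consecutive days numbered $0,1,\dots$. There is a maximum daily working time $T\ge 0$, a maximum daily driving distance $Dist\ge 0$ and a break length $B\ge 0$. Vehicle $k$ has capacity $L_k$ and a finite set of compartments $\mathcal M_k$, where $m\in\mathcal M_k$ has maximum capacity $\overline L_{mk}$ with $0\le\overline L_{mk}\le L_k$. The parameter $b_{nm}^k\in\{0,1\}$ equals $1$ iff client $n$ may be assigned to compartment $m$ of vehicle $k$; $f_{ij}\in\{0,1\}$ equals $1$ iff the items of clients $i$ and $j$ are compatible. Dual values $\pi_n\in\mathbb R$ ($n\in\mathcal N$) are given; put $\overline\pi_n=\pi_n$ for $n\in\mathcal N$, $\overline\pi_\sigma=\overline\pi_\delta=0$, and let $\overline c_{ij}=c_{ij}-\overline\pi_i$ be the reduced cost of arc $(i,j)$. Conventions for the depot: $u_\sigma=0$; $\delta$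 imposes no time-window restriction (window $[0,\infty)$), has zero demand and uses no compartment. **Labels.** A label is a tuple $L=(i,t,\bar c,d,\mathcal S,(l_m^k)_{m\in\mathcal M_k},(O_m^k)_{m\in\mathcal M_k},g,o)$, representing a partial path from $\sigma$ to $i$ served by vehicle $k$: $i(L)\in\mathcal V$ is the last visited node, $t(L)\ge0$ the accumulated time, $\bar c(L)\in\mathbb R$ the accumulated reduced cost, $d(L)\in\mathcal D$ the day, $\mathcal S(L)\subseteq\mathcal N$ the set of visited clients, $l_m^k(L)\ge0$ the load in compartment $m$, $O_m^k(L)\subseteq\mathcal N$ the clients loaded in compartment $m$, $g(L)\ge0$ the working time accumulated in the current day, and $o(L)\ge0$ the driving distance accumulated in the current day. The initial label is $(\sigma,0,0,0,\emptyset,(0)_m,(\emptyset)_m,0,0)$. Labels are those obtained from the initial label by successive feasible extensions. **Extensions.** An extension $h$ of $L$, with $i(L)=i$, along an arc $(i,j)\in\mathcal A$ is given by a compartment $m^h\in\mathcal M_k$ (if $j\in\mathcal N$) and a choice $d_{ij}\in\{0,1\}$, where $d_{ij}=1$ means that a break of length $B$ is taken immediately at $i$ before driving to $j$, so that deliveries start on the next day from $j$. It produces the label $L_h$ with - $i(L_h)=j$; - $t(L_h)=\max\{t(L)+t_{ij}+u_i+B\,d_{ij},\ s_j^{\bar p}\}$, where $\bar p$ is the smallest index $p$ with $t(L)+t_{ij}+u_i+B\,d_{ij}\le e_j^p$ (the earliest reachable window; if none exists, the extension is infeasible); - $\bar c(L_h)=\bar c(L)+\overline c_{ij}$; - $d(L_h)=d(L)+d_{ij}$;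 - $\mathcal S(L_h)=\mathcal S(L)\cup\{j\}$ if $j\in\mathcal N$ (unchanged if $j=\delta$); - $l_m^k(L_h)=l_m^k(L)+Q_j$ if $m=m^h$, and $l_m^k(L_h)=l_m^k(L)$ otherwise; - $O_m^k(L_h)=O_m^k(L)\cup\{j\}$ if $m=m^h$, and $O_m^k(L_h)=O_m^k(L)$ otherwise; - $g(L_h)=g(L)+t_{ij}+u_i$ if $d_{ij}=0$, and $g(L_h)=0$ if $d_{ij}=1$; - $o(L_h)=o(L)+dist_{ij}$ if $d_{ij}=0$, and $o(L_h)=0$ if $d_{ij}=1$. The extension is feasible iff $j\notin\mathcal S(L)$, $d(L_h)\in\mathcal D$, $t(L_h)\le e_j^{\bar p}$, $l_m^k(L_h)\le\overline L_{mk}$ for all $m\in\mathcal M_k$, $\sum_{m\in\mathcal M_k}l_m^k(L_h)\le L_k$, $g(L_h)\le T$, $o(L_h)\le Dist$, and, when $j\in\mathcal N$, $b_{j m^h}^k=1$ and $f_{nj}=1$ for all $n\in O_{m^h}^k(L)$. Feasibility is determined by exactly these conditions; in particular the day counter $d$ is not otherwise linked to the accumulated time or to the windows (days may be skipped). **Completion and validity.** A feasible completion of $L$ is a finite (possibly empty) sequence of successive feasible extensions starting from $L$ and ending in a label at $\delta$; its final reduced cost is the $\bar c$-value of that last label. Labels at $\delta$ are not extended further. A dominance rule (a set of conditions on pairs $(L_1,L_2)$) is valid if, whenever $(L_1,L_2)$ satisfies it, each feasible completion of $L_2$ is matched by a feasible completion of $L_1$ with final reduced cost no larger. *)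

theory Defs
  imports Complex_Main "HOL-Library.Extended_Real"
begin

text \<open>
  Data of the pricing problem. Arc data (\<open>cost\<close>, \<open>duration\<close>, \<open>distance\<close>) are read only on \<open>arcs\<close>,
  client data only on \<open>clients\<close>, and compartment data only on \<open>compartments I k\<close>.
  The 0/1 parameters \<open>b\<close> and \<open>f\<close> are the predicates \<open>assignable\<close> and \<open>compatible\<close>.
\<close>

record ('v, 'k, 'm) pricing_data =
  clients :: "'v set"
  origin :: 'v
  dest :: 'v
  arcs :: "('v \<times> 'v) set"
  demand :: "'v \<Rightarrow> real"
  service :: "'v \<Rightarrow> real"
  windows :: "'v \<Rightarrow> (real \<times> real) list"
  cost :: "'v \<Rightarrow> 'v \<Rightarrow> real"
  duration :: "'v \<Rightarrow> 'v \<Rightarrow> real"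
  distance :: "'v \<Rightarrow> 'v \<Rightarrow> real"
  days :: "nat set"
  max_work :: real
  max_dist :: real
  break_len :: real
  vehicles :: "'k set"
  capacity :: "'k \<Rightarrow> real"
  compartments :: "'k \<Rightarrow> 'm set"
  comp_capacity :: "'k \<Rightarrow> 'm \<Rightarrow> real"
  assignable :: "'k \<Rightarrow> 'v \<Rightarrow> 'm \<Rightarrow> bool"
  compatible :: "'v \<Rightarrow> 'v \<Rightarrow> bool"
  dual :: "'v \<Rightarrow> real"

definition vertices :: "('v, 'k, 'm) pricing_data \<Rightarrow> 'v set" where
  "vertices I = clients I \<union> {origin I, dest I}"

locale pricing_instance =
  fixes I :: "('v, 'k, 'm) pricing_data"
  assumes finite_clients: "finite (clients I)"
    and depot_not_client: "origin I \<notin> clients I" "dest I \<notin> clients I"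
    and origin_neq_dest: "origin I \<noteq> dest I"
    and arcs_subset: "arcs I \<subseteq> vertices I \<times> vertices I"
    and demand_nonneg: "\<And>n. n \<in> clients I \<Longrightarrow> 0 \<le> demand I n"
    and service_nonneg: "\<And>n. n \<in> clients I \<Longrightarrow> 0 \<le> service I n"
    and windows_nonempty: "\<And>n. n \<in> clients I \<Longrightarrow> windows I n \<noteq> []"
    and windows_intervals:
      "\<And>n s e. n \<in> clients I \<Longrightarrow> (s, e) \<in> set (windows I n) \<Longrightarrow> 0 \<le> s \<and> s \<le> e"
    \<comment> \<open>for nonempty closed intervals: pairwise disjoint and in chronological order\<close>
    and windows_ordered:
      "\<And>n. n \<in> clients I \<Longrightarrow> sorted_wrt (\<lambda>(s, e) (s', e'). e < s') (windows I n)"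
    and duration_nonneg: "\<And>i j. (i, j) \<in> arcs I \<Longrightarrow> 0 \<le> duration I i j"
    and distance_nonneg: "\<And>i j. (i, j) \<in> arcs I \<Longrightarrow> 0 \<le> distance I i j"
    and cost_triangle:
      "\<And>i j l. (i, j) \<in> arcs I \<Longrightarrow> (j, l) \<in> arcs I \<Longrightarrow> (i, l) \<in> arcs I \<Longrightarrow>
        cost I i l \<le> cost I i j + cost I j l"
    and duration_triangle:
      "\<And>i j l. (i, j) \<in> arcs I \<Longrightarrow> (j, l) \<in> arcs I \<Longrightarrow> (i, l) \<in> arcs I \<Longrightarrow>
        duration I i l \<le> duration I i j + duration I j l"
    \<comment> \<open>\<open>days I\<close> is a nonempty initial segment of the naturals, possibly infinite\<close>
    and zero_day: "0 \<in> days I"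
    and days_consecutive: "\<And>d d'. d \<in> days I \<Longrightarrow> d' \<le> d \<Longrightarrow> d' \<in> days I"
    and max_work_nonneg: "0 \<le> max_work I"
    and max_dist_nonneg: "0 \<le> max_dist I"
    and break_len_nonneg: "0 \<le> break_len I"
    and finite_compartments: "\<And>k. k \<in> vehicles I \<Longrightarrow> finite (compartments I k)"
    and comp_capacity_bounds:
      "\<And>k m. k \<in> vehicles I \<Longrightarrow> m \<in> compartments I k \<Longrightarrow>
        0 \<le> comp_capacity I k m \<and> comp_capacity I k m \<le> capacity I k"

definition node_dual :: "('v, 'k, 'm) pricing_data \<Rightarrow> 'v \<Rightarrow> real" where
  "node_dual I i = (if i \<in> clients I then dual I i else 0)"

definition reduced_cost :: "('v, 'k, 'm) pricing_data \<Rightarrow> 'v \<Rightarrow> 'v \<Rightarrow> real" where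
  "reduced_cost I i j = cost I i j - node_dual I i"

definition node_service :: "('v, 'k, 'm) pricing_data \<Rightarrow> 'v \<Rightarrow> real" where
  "node_service I i = (if i \<in> clients I then service I i else 0)"

definition node_windows :: "('v, 'k, 'm) pricing_data \<Rightarrow> 'v \<Rightarrow> (real \<times> ereal) list" where
  "node_windows I j =
    (if j = dest I then [(0, \<infinity>)] else map (\<lambda>(s, e). (s, ereal e)) (windows I j))"

text \<open>
  The window with the smallest index whose end is not before \<open>\<tau>\<close>; \<open>None\<close> if there is none.
\<close>

definition reached_window ::
  "('v, 'k, 'm) pricing_data \<Rightarrow> 'v \<Rightarrow> real \<Rightarrow> (real \<times> ereal) option" where
  "reached_window I j \<tau> = find (\<lambda>(s, e). ereal \<tau> \<le> e) (node_windows I j)"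

record ('v, 'm) label =
  node :: 'v
  time :: real
  rcost :: real
  day :: nat
  visited :: "'v set"
  load :: "'m \<Rightarrow> real"
  loaded :: "'m \<Rightarrow> 'v set"
  work :: real
  driven :: real

definition initial_label :: "('v, 'k, 'm) pricing_data \<Rightarrow> ('v, 'm) label" where
  "initial_label I =
    \<lparr>node = origin I, time = 0, rcost = 0, day = 0, visited = {},
     load = (\<lambda>_. 0), loaded = (\<lambda>_. {}), work = 0, driven = 0\<rparr>"

text \<open>
  An extension is given by the head of the arc (the tail being the node of the label), the
  compartment used (\<open>None\<close> at the destination), and whether a break is taken before driving.
\<close>

record ('v, 'm) extension =
  head :: 'v
  compartment :: "'m option"
  takes_break :: bool

definition arrival ::
  "('v, 'k, 'm) pricing_data \<Rightarrow> ('v, 'm) extension \<Rightarrow> ('v, 'm) label \<Rightarrow> real" where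
  "arrival I h L =
    time L + duration I (node L) (head h) + node_service I (node L)
      + break_len I * of_bool (takes_break h)"

text \<open>
  The time component is meaningful only if some window is reachable; this is part of \<open>feasible\<close>.
\<close>

definition extend ::
  "('v, 'k, 'm) pricing_data \<Rightarrow> ('v, 'm) extension \<Rightarrow> ('v, 'm) label \<Rightarrow> ('v, 'm) label" where
  "extend I h L =
    (let i = node L; j = head h in
     \<lparr>node = j,
      time = max (arrival I h L) (fst (the (reached_window I j (arrival I h L)))),
      rcost = rcost L + reduced_cost I i j,
      day = day L + of_bool (takes_break h),
      visited = (if j \<in> clients I then visited L \<union> {j} else visited L),
      load = (\<lambda>m. if compartment h = Some m then load L m + demand I j else load L m),
      loaded = (\<lambda>m. if compartment h = Some m then loaded L m \<union> {j} else loaded L m),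
      work = (if takes_break h then 0 else work L + duration I i j + node_service I i),
      driven = (if takes_break h then 0 else driven L + distance I i j)\<rparr>)"

definition feasible ::
  "('v, 'k, 'm) pricing_data \<Rightarrow> 'k \<Rightarrow> ('v, 'm) label \<Rightarrow> ('v, 'm) extension \<Rightarrow> bool" where
  "feasible I k L h \<longleftrightarrow>
    (let j = head h; L' = extend I h L in
     node L \<noteq> dest I \<and> (node L, j) \<in> arcs I \<and>
     (j \<in> clients I \<and> (\<exists>m \<in> compartments I k. compartment h = Some m) \<or>
      j = dest I \<and> compartment h = None) \<and>
     j \<notin> visited L \<and>
     day L' \<in> days I \<and>
     (\<exists>s e. reached_window I j (arrival I h L) = Some (s, e) \<and> ereal (time L') \<le> e) \<and>
     (\<forall>m \<in> compartments I k. load L' m \<le> comp_capacity I k m) \<and>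
     (\<Sum>m \<in> compartments I k. load L' m) \<le> capacity I k \<and>
     work L' \<le> max_work I \<and>
     driven L' \<le> max_dist I \<and>
     (\<forall>m. compartment h = Some m \<longrightarrow>
        assignable I k j m \<and> (\<forall>n \<in> loaded L m. compatible I n j)))"

inductive_set labels :: "('v, 'k, 'm) pricing_data \<Rightarrow> 'k \<Rightarrow> ('v, 'm) label set"
  for I :: "('v, 'k, 'm) pricing_data" and k :: 'k where
  initial: "initial_label I \<in> labels I k"
| extend: "L \<in> labels I k \<Longrightarrow> feasible I k L h \<Longrightarrow> extend I h L \<in> labels I k"

fun feasible_seq ::
  "('v, 'k, 'm) pricing_data \<Rightarrow> 'k \<Rightarrow> ('v, 'm) label \<Rightarrow> ('v, 'm) extension list \<Rightarrow> bool" where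
  "feasible_seq I k L [] \<longleftrightarrow> True"
| "feasible_seq I k L (h # hs) \<longleftrightarrow> feasible I k L h \<and> feasible_seq I k (extend I h L) hs"

definition final_label ::
  "('v, 'k, 'm) pricing_data \<Rightarrow> ('v, 'm) label \<Rightarrow> ('v, 'm) extension list \<Rightarrow> ('v, 'm) label" where
  "final_label I L hs = fold (extend I) hs L"

definition feasible_completion ::
  "('v, 'k, 'm) pricing_data \<Rightarrow> 'k \<Rightarrow> ('v, 'm) label \<Rightarrow> ('v, 'm) extension list \<Rightarrow> bool" where
  "feasible_completion I k L hs \<longleftrightarrow>
    feasible_seq I k L hs \<and> node (final_label I L hs) = dest I"

definition valid_dominance_rule ::
  "('v, 'k, 'm) pricing_data \<Rightarrow> 'k \<Rightarrow> (('v, 'm) label \<Rightarrow> ('v, 'm) label \<Rightarrow> bool) \<Rightarrow> bool" where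
  "valid_dominance_rule I k R \<longleftrightarrow>
    (\<forall>L1 \<in> labels I k. \<forall>L2 \<in> labels I k. R L1 L2 \<longrightarrow>
      (\<forall>hs2. feasible_completion I k L2 hs2 \<longrightarrow>
        (\<exists>hs1. feasible_completion I k L1 hs1 \<and>
          rcost (final_label I L1 hs1) \<le> rcost (final_label I L2 hs2))))"

definition dominates ::
  "('v, 'k, 'm) pricing_data \<Rightarrow> 'k \<Rightarrow> ('v, 'm) label \<Rightarrow> ('v, 'm) label \<Rightarrow> bool" where
  "dominates I k L1 L2 \<longleftrightarrow>
    node L1 = node L2 \<and> time L1 \<le> time L2 \<and> rcost L1 \<le> rcost L2 \<and> day L1 = day L2 \<and>
    visited L1 \<subseteq> visited L2 \<and>
    (\<forall>m \<in> compartments I k. load L1 m \<le> load L2 m \<and> loaded L1 m \<subseteq> loaded L2 m) \<and>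
    work L1 \<le> work L2 \<and> driven L1 \<le> driven L2"

end

theory Submission
  imports Defs
begin

text \<open>
  The completion of \<open>L2\<close> can be replayed from \<open>L1\<close> without any change: dominance is a
  simulation. If \<open>L1\<close> dominates \<open>L2\<close> and an extension is feasible for \<open>L2\<close>, then the same
  extension is feasible for \<open>L1\<close>, and the two results are again related by dominance. The
  conditions of feasibility concern the node and the day, on which the labels agree, or are upper
  bounds on resources, or restrict the members of the visited and loaded sets; they are therefore
  inherited by the dominating label. Apart from the time, every component is updated monotonically:
  both labels gain the same amount or the same client, or are reset to zero.

  The time is the only component that needs an argument, because an earlier arrival may reach
  a different window, for whose start it may have to wait. This does no harm since
  the windows are disjoint and chronological (\<open>earlier_arrival_starts_earlier\<close>). Iterating
  the simulation step (\<open>dominating_extension\<close>) along the completion gives the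
  theorem, as dominance includes the comparison of the reduced costs.
\<close>

text \<open>
  If both arrivals reach the same window, the claim is monotonicity of \<open>max\<close>. Otherwise the earlier
  arrival reaches a window that ends before the other one starts, and it begins its service
  within that window.
\<close>

lemma earlier_arrival_starts_earlier:
  fixes ws :: "(real \<times> ereal) list"
  assumes "sorted_wrt (\<lambda>(s, e) (s', e'). e < ereal s') ws"
    and "\<And>s e. (s, e) \<in> set ws \<Longrightarrow> ereal s \<le> e"
    and "a1 \<le> a2"
    and "find (\<lambda>(s, e). ereal a2 \<le> e) ws = Some (s2, e2)"
  shows "\<exists>s1 e1. find (\<lambda>(s, e). ereal a1 \<le> e) ws = Some (s1, e1) \<and>
    max a1 s1 \<le> max a2 s2 \<and> ereal (max a1 s1) \<le> e1"
  using assms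
proof (induction ws)
  case Nil
  then show ?case by simp
next
  case (Cons w ws)
  obtain s e where w: "w = (s, e)" by (cases w)
  have se: "ereal s \<le> e" using Cons.prems(2) w by simp
  show ?case
  proof (cases "ereal a1 \<le> e")
    case True
    have "max a1 s \<le> max a2 s2"
    proof (cases "ereal a2 \<le> e")
      case True
      then show ?thesis using Cons.prems(3,4) w by auto
    next
      case False
      then have "find (\<lambda>(s, e). ereal a2 \<le> e) ws = Some (s2, e2)"
        using Cons.prems(4) w by simp
      then have "(s2, e2) \<in> set ws"
        by (auto simp: find_Some_iff in_set_conv_nth)
      then have "e < ereal s2" using Cons.prems(1) w by auto
      then have "ereal (max a1 s) < ereal s2"
        using se True by (metis le_less_trans max_def)
      then show ?thesis by (simp add: le_max_iff_disj)
    qed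
    then show ?thesis using True se w by (auto simp: max_def)
  next
    case False
    then have "\<not> ereal a2 \<le> e"
      using Cons.prems(3) by (meson ereal_less_eq(3) order_trans)
    then show ?thesis using False Cons w by simp
  qed
qed

context pricing_instance
begin

lemma node_windows_chronological:
  assumes "j \<in> clients I \<or> j = dest I"
  shows "sorted_wrt (\<lambda>(s, e) (s', e'). e < ereal s') (node_windows I j)"
    and "(s, e) \<in> set (node_windows I j) \<Longrightarrow> ereal s \<le> e"
proof -
  show "sorted_wrt (\<lambda>(s, e) (s', e'). e < ereal s') (node_windows I j)"
    using windows_ordered[of j] assms
    by (auto simp: node_windows_def sorted_wrt_map case_prod_unfold)
  show "(s, e) \<in> set (node_windows I j) \<Longrightarrow> ereal s \<le> e"
    using windows_intervals[of j] assms
    by (auto simp: node_windows_def split: if_splits)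
qed

text \<open>
  The simulation step. Dominance compares the loaded clients only on the compartments of the
  vehicle; this suffices for compatibility because feasibility for \<open>L2\<close> forces the
  compartment used to be one of them. It also forces the head to be a client or the destination,
  so that its windows are known to be chronological.
\<close>

lemma dominating_extension:
  assumes dom: "dominates I k L1 L2" and feas: "feasible I k L2 h"
  shows "feasible I k L1 h" and "dominates I k (extend I h L1) (extend I h L2)"
proof -
  let ?j = "head h"
  let ?a1 = "arrival I h L1" and ?a2 = "arrival I h L2"
  have arrival_le: "?a1 \<le> ?a2"
    using dom by (simp add: dominates_def arrival_def)
  have head: "?j \<in> clients I \<or> ?j = dest I"
    using feas by (auto simp: feasible_def Let_def)
  obtain s2 e2 where w2: "reached_window I ?j ?a2 = Some (s2, e2)"
    using feas by (auto simp: feasible_def Let_def)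
  obtain s1 e1 where w1: "reached_window I ?j ?a1 = Some (s1, e1)"
    and start_le: "max ?a1 s1 \<le> max ?a2 s2" and start_in: "ereal (max ?a1 s1) \<le> e1"
    using earlier_arrival_starts_earlier
      [OF node_windows_chronological[OF head] arrival_le w2[unfolded reached_window_def]]
    by (auto simp: reached_window_def)
  have time1: "time (extend I h L1) = max ?a1 s1"
    and time2: "time (extend I h L2) = max ?a2 s2"
    using w1 w2 by (simp_all add: extend_def Let_def)
  show dom': "dominates I k (extend I h L1) (extend I h L2)"
    using dom start_le unfolding dominates_def time1 time2
    by (auto simp: extend_def Let_def)
  have loads: "load (extend I h L1) m \<le> load (extend I h L2) m" if "m \<in> compartments I k" for m
    using dom' that by (simp add: dominates_def)
  have total: "(\<Sum>m\<in>compartments I k. load (extend I h L1) m)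
      \<le> (\<Sum>m\<in>compartments I k. load (extend I h L2) m)"
    by (rule sum_mono) (rule loads)
  have bounds: "day (extend I h L1) \<in> days I"
    "\<forall>m\<in>compartments I k. load (extend I h L1) m \<le> comp_capacity I k m"
    "(\<Sum>m\<in>compartments I k. load (extend I h L1) m) \<le> capacity I k"
    "work (extend I h L1) \<le> max_work I" "driven (extend I h L1) \<le> max_dist I"
    using feas dom' total loads
    by (force simp: feasible_def Let_def dominates_def)+
  have arc: "node L1 \<noteq> dest I" "(node L1, ?j) \<in> arcs I" "?j \<notin> visited L1"
    "?j \<in> clients I \<and> (\<exists>m\<in>compartments I k. compartment h = Some m) \<or>
      ?j = dest I \<and> compartment h = None"
    using feas dom by (auto simp: feasible_def Let_def dominates_def)
  have compat: "\<forall>m. compartment h = Some m \<longrightarrow>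
      assignable I k ?j m \<and> (\<forall>n\<in>loaded L1 m. compatible I n ?j)"
    using feas dom by (fastforce simp: feasible_def Let_def dominates_def)
  show "feasible I k L1 h"
    using arc bounds compat w1 start_in time1 by (simp add: feasible_def Let_def)
qed

lemma dominating_completion:
  assumes "dominates I k L1 L2" and "feasible_seq I k L2 hs"
  shows "feasible_seq I k L1 hs \<and> dominates I k (final_label I L1 hs) (final_label I L2 hs)"
  using assms
proof (induction hs arbitrary: L1 L2)
  case Nil
  then show ?case by (simp add: final_label_def)
next
  case (Cons h hs)
  then show ?case
    using dominating_extension[of k L1 L2 h] by (simp add: final_label_def)
qed

end

theorem proposition1:
  fixes I :: "('v, 'k, 'm) pricing_data" and k :: 'k
  assumes "pricing_instance I" and "k \<in> vehicles I"
  shows "valid_dominance_rule I k (dominates I k)"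
proof -
  interpret pricing_instance I by (rule assms(1))
  have "feasible_completion I k L1 hs \<and>
      rcost (final_label I L1 hs) \<le> rcost (final_label I L2 hs)"
    if "dominates I k L1 L2" and "feasible_completion I k L2 hs" for L1 L2 hs
    using dominating_completion[OF that(1), of hs] that(2)
    by (auto simp: feasible_completion_def dominates_def)
  then show ?thesis
    unfolding valid_dominance_rule_def by blast
qed

end
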